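(* Let $\mathcal{Y}$ be the space of all possible trajectories, let $\mathcal{P}(\mathcal{Y})$ be the set of all probability distributions on $\mathcal{Y}$, equipped with the $1$-Wasserstein metric $W_1$, and let $H\ge 1$ be an integer (the prediction horizon). Let $CP$ (the conformal prediction map) send each trajectory distribution $\mathcal{D}\in\mathcal{P}(\mathcal{Y})$ to a threshold vector $\boldsymbol{q}=CP(\mathcal{D})\in\mathbb{R}^H$, and let $F$ (the MPC map) send each threshold vector $\boldsymbol{q}$ to a trajectory distribution $F(\boldsymbol{q})\in\mathcal{P}(\mathcal{Y})$. Assume: (i) (Lipschitz continuity of conformal prediction) there exists $L_{\mathrm{CP}}\ge 0$ such that for any two trajectory distributions $\mathcal{D}_1,\mathcal{D}_2$, $$|CP(\mathcal{D}_1)-CP(\mathcal{D}_2)|\le L_{\mathrm{CP}}\,W_1(\mathcal{D}_1,\mathcal{D}_2);$$ (ii) (Lipschitz continuity of MPC) there exists $L_{\mathrm{MPC}}\ge 0$ such that for any two threshold vectors $\boldsymbol{q}_1,\boldsymbol{q}_2$, $$W_1(F(\boldsymbol{q}_1),F(\boldsymbol{q}_2))\le L_{\mathrm{MPC}}\,|\boldsymbol{q}_1-\boldsymbol{q}_2|.$$ If the combined Lipschitz constant satisfies $\delta=L_{\mathrm{MPC}}\cdot L_{\mathrm{CP}}<1$, then the operator $\mathcal{T}=F\circ CP$ is a contraction mapping on the space of trajectory distributions equipped with the Wasserstein metric, $(\mathcal{P}(\mathcal{Y}),W_1)$. Consequently, the iteration $\mathcal{D}^{(r+1)}=\mathcal{T}(\mathcal{D}^{(r)})$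 converges to a unique fixed-point distribution $\mathcal{D}^*=\lim_{r\to\infty}\mathcal{D}^{(r)}$.
   Context: $\mathcal{Y}$ is the space of joint trajectories of interacting agents. $CP$ assigns to a trajectory distribution $\mathcal{D}$ a vector $\boldsymbol{q}=(q_1,\dots,q_H)$ of conformal prediction thresholds on the trajectory prediction error, one for each step of the prediction horizon; it is treated as a map on distributions. $F$ assigns to $\boldsymbol{q}$ the trajectory distribution induced by running a model predictive controller (MPC) whose collision-avoidance constraints are tightened by $\boldsymbol{q}$. The map $\mathcal{T}=F\circ CP:\mathcal{P}(\mathcal{Y})\to\mathcal{P}(\mathcal{Y})$ models the distribution shift caused by deploying the recalibrated controller, and $\mathcal{D}^{(r)}$ is the trajectory distribution at iteration $r$, starting from an initial distribution $\mathcal{D}^{(0)}\in\mathcal{P}(\mathcal{Y})$. Here $|\cdot|$ denotes a norm on threshold vectors, and $W_1$ is the $1$-Wasserstein distance between probability distributions on $\mathcal{Y}$, taken with respect to the underlying distance $d$ on $\mathcal{Y}$: $W_1(\mu,\nu)=\inf_\pi\int d(y,y')\,d\pi(y,y')$ over all couplings $\pi$ of $\mu$ and $\nu$. A contraction mapping is a self-map of a metric space that is Lipschitz with some constant strictly less than $1$. *)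

theory Defs
  imports "HOL-Probability.Probability"
begin

text \<open>
  Trajectories form a separable metric space \<open>'y\<close> with distance \<^const>\<open>dist\<close>. Separability makes
  \<^const>\<open>dist\<close> measurable for the product \<open>\<sigma>\<close>-algebra, so that the transport cost below is a genuine
  integral. Neither completeness nor boundedness is required.
\<close>

definition distributions :: "'y::{metric_space, second_countable_topology} measure set" where
  "distributions = space (prob_algebra borel)"

lemma distributions_iff: "\<mu> \<in> distributions \<longleftrightarrow> prob_space \<mu> \<and> sets \<mu> = sets borel"
  by (auto simp: distributions_def space_prob_algebra)

definition couplings ::
  "'y::{metric_space, second_countable_topology} measure \<Rightarrow> 'y measure \<Rightarrow> ('y \<times> 'y) measure set" where
  "couplings \<mu> \<nu> =
    {\<pi> \<in> space (prob_algebra (borel \<Otimes>\<^sub>M borel)). distr \<pi> borel fst = \<mu> \<and> distr \<pi> borel snd = \<nu>}"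

text \<open>The value may be \<open>\<infinity>\<close>, since distributions are not required to have a finite first moment.\<close>

definition wasserstein1 ::
  "'y::{metric_space, second_countable_topology} measure \<Rightarrow> 'y measure \<Rightarrow> ennreal" where
  "wasserstein1 \<mu> \<nu> = (INF \<pi>\<in>couplings \<mu> \<nu>. \<integral>\<^sup>+ (y, y'). ennreal (dist y y') \<partial>\<pi>)"

text \<open>
  The library's metric spaces have real-valued distances; this is the same notion with the value
  \<open>\<infinity>\<close> allowed.
\<close>

definition extended_metric_on :: "'a set \<Rightarrow> ('a \<Rightarrow> 'a \<Rightarrow> ennreal) \<Rightarrow> bool" where
  "extended_metric_on M d \<longleftrightarrow>
    (\<forall>x\<in>M. \<forall>y\<in>M. d x y = 0 \<longleftrightarrow> x = y) \<and>
    (\<forall>x\<in>M. \<forall>y\<in>M. d x y = d y x) \<and>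
    (\<forall>x\<in>M. \<forall>y\<in>M. \<forall>z\<in>M. d x z \<le> d x y + d y z)"

definition contraction_mapping :: "'a set \<Rightarrow> ('a \<Rightarrow> 'a \<Rightarrow> ennreal) \<Rightarrow> ('a \<Rightarrow> 'a) \<Rightarrow> bool" where
  "contraction_mapping M d T \<longleftrightarrow>
    extended_metric_on M d \<and> T \<in> M \<rightarrow> M \<and>
    (\<exists>k::real. 0 \<le> k \<and> k < 1 \<and> (\<forall>x\<in>M. \<forall>y\<in>M. d (T x) (T y) \<le> ennreal k * d x y))"

text \<open>
  An arbitrary norm, not necessarily the Euclidean one that the library fixes on \<^typ>\<open>real ^ 'h\<close>.
  Nonnegativity follows from the three conditions.
\<close>

definition is_norm :: "('v::real_vector \<Rightarrow> real) \<Rightarrow> bool" where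
  "is_norm N \<longleftrightarrow>
    (\<forall>x. N x = 0 \<longleftrightarrow> x = 0) \<and>
    (\<forall>a x. N (a *\<^sub>R x) = \<bar>a\<bar> * N x) \<and>
    (\<forall>x y. N (x + y) \<le> N x + N y)"

end

theory Submission
  imports Defs
begin

text \<open>
  The fixed point is found among the thresholds, not among the distributions, where \<open>W\<^sub>1\<close> may be
  infinite or incomplete: \<open>CP \<circ> F\<close> is a contraction of the finite-dimensional normed space
  of thresholds, so it has a unique fixed point \<open>q\<close>, and \<open>F q\<close> is then the unique fixed point of
  \<open>F \<circ> CP\<close>. Convergence is geometric after the first step, because thresholds are at finite
  distance from each other.

  For the triangle inequality of \<open>W\<^sub>1\<close>, two couplings are glued without disintegration, which would
  require completeness: the middle space is cut into countably many cells of diameter at most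
  \<open>e\<close>, and the couplings are glued independently within each cell, at an extra cost of at most \<open>e\<close>.
\<close>

section \<open>Couplings, reflexivity and symmetry of \<open>W\<^sub>1\<close>\<close>

lemma couplingsD:
  assumes "\<pi> \<in> couplings \<mu> \<nu>"
  shows "prob_space \<pi>" "sets \<pi> = sets (borel \<Otimes>\<^sub>M borel)"
    "distr \<pi> borel fst = \<mu>" "distr \<pi> borel snd = \<nu>"
  using assms by (auto simp: couplings_def space_prob_algebra)

lemma couplingsI:
  assumes "prob_space \<pi>" "sets \<pi> = sets (borel \<Otimes>\<^sub>M borel)"
    "distr \<pi> borel fst = \<mu>" "distr \<pi> borel snd = \<nu>"
  shows "\<pi> \<in> couplings \<mu> \<nu>"
  using assms by (auto simp: couplings_def space_prob_algebra)

lemma nn_integral_coupling: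
  assumes "\<pi> \<in> couplings \<mu> \<nu>" "f \<in> borel_measurable borel"
  shows "(\<integral>\<^sup>+ p. f (fst p) \<partial>\<pi>) = (\<integral>\<^sup>+ y. f y \<partial>\<mu>)"
    and "(\<integral>\<^sup>+ p. f (snd p) \<partial>\<pi>) = (\<integral>\<^sup>+ y. f y \<partial>\<nu>)"
proof -
  note [measurable_cong] = couplingsD(2)[OF assms(1)]
  have [measurable]: "fst \<in> \<pi> \<rightarrow>\<^sub>M borel" "snd \<in> \<pi> \<rightarrow>\<^sub>M borel" by measurable
  show "(\<integral>\<^sup>+ p. f (fst p) \<partial>\<pi>) = (\<integral>\<^sup>+ y. f y \<partial>\<mu>)"
    by (subst couplingsD(3)[OF assms(1), symmetric]) (use assms(2) in \<open>simp add: nn_integral_distr\<close>)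
  show "(\<integral>\<^sup>+ p. f (snd p) \<partial>\<pi>) = (\<integral>\<^sup>+ y. f y \<partial>\<nu>)"
    by (subst couplingsD(4)[OF assms(1), symmetric]) (use assms(2) in \<open>simp add: nn_integral_distr\<close>)
qed

lemma wasserstein1_le:
  "\<pi> \<in> couplings \<mu> \<nu> \<Longrightarrow> wasserstein1 \<mu> \<nu> \<le> (\<integral>\<^sup>+ p. ennreal (dist (fst p) (snd p)) \<partial>\<pi>)"
  unfolding wasserstein1_def by (intro INF_lower2[of \<pi>]) (auto simp: case_prod_unfold)

lemma le_wasserstein1:
  assumes "\<And>\<pi>. \<pi> \<in> couplings \<mu> \<nu> \<Longrightarrow> c \<le> (\<integral>\<^sup>+ p. ennreal (dist (fst p) (snd p)) \<partial>\<pi>)"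
  shows "c \<le> wasserstein1 \<mu> \<nu>"
  unfolding wasserstein1_def using assms by (intro INF_greatest) (auto simp: case_prod_unfold)

lemma wasserstein1_lessE:
  assumes "wasserstein1 \<mu> \<nu> < c"
  obtains \<pi> where "\<pi> \<in> couplings \<mu> \<nu>" "(\<integral>\<^sup>+ p. ennreal (dist (fst p) (snd p)) \<partial>\<pi>) < c"
  using assms unfolding wasserstein1_def INF_less_iff case_prod_unfold by blast

lemma wasserstein1_refl:
  fixes \<mu> :: "'y::{metric_space, second_countable_topology} measure"
  assumes "\<mu> \<in> distributions"
  shows "wasserstein1 \<mu> \<mu> = 0"
proof -
  interpret prob_space \<mu> using assms by (simp add: distributions_iff)
  have [measurable_cong]: "sets \<mu> = sets borel" using assms by (simp add: distributions_iff)
  define \<pi> where "\<pi> = distr \<mu> (borel \<Otimes>\<^sub>M borel) (\<lambda>y. (y, y))"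
  have "\<pi> \<in> couplings \<mu> \<mu>"
  proof (rule couplingsI)
    show "prob_space \<pi>" unfolding \<pi>_def by (rule prob_space_distr) measurable
    show "sets \<pi> = sets (borel \<Otimes>\<^sub>M borel)" by (simp add: \<pi>_def)
    show "distr \<pi> borel fst = \<mu>" "distr \<pi> borel snd = \<mu>"
      by (simp_all add: \<pi>_def distr_distr comp_def distr_id2 \<open>sets \<mu> = sets borel\<close>)
  qed
  then have "wasserstein1 \<mu> \<mu> \<le> (\<integral>\<^sup>+ p. ennreal (dist (fst p) (snd p)) \<partial>\<pi>)"
    by (rule wasserstein1_le)
  also have "\<dots> = 0" by (simp add: \<pi>_def nn_integral_distr)
  finally show ?thesis by simp
qed

text \<open>Exchanging the coordinates turns each coupling into one for the reversed pair at the
  same cost; applied in both directions this yields symmetry.\<close>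

lemma wasserstein1_commute_le:
  fixes \<mu> :: "'y::{metric_space, second_countable_topology} measure"
  shows "wasserstein1 \<mu> \<nu> \<le> wasserstein1 \<nu> \<mu>"
proof (rule le_wasserstein1)
  fix \<pi> :: "('y \<times> 'y) measure" assume \<pi>: "\<pi> \<in> couplings \<nu> \<mu>"
  note [measurable_cong] = couplingsD(2)[OF \<pi>]
  define \<pi>' where "\<pi>' = distr \<pi> (borel \<Otimes>\<^sub>M borel) (\<lambda>p. (snd p, fst p))"
  have "\<pi>' \<in> couplings \<mu> \<nu>"
  proof (rule couplingsI)
    show "prob_space \<pi>'"
      unfolding \<pi>'_def by (rule prob_space.prob_space_distr[OF couplingsD(1)[OF \<pi>]]) measurable
    show "sets \<pi>' = sets (borel \<Otimes>\<^sub>M borel)" by (simp add: \<pi>'_def)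
    show "distr \<pi>' borel fst = \<mu>" "distr \<pi>' borel snd = \<nu>"
      using couplingsD(3,4)[OF \<pi>] by (simp_all add: \<pi>'_def distr_distr comp_def)
  qed
  then have "wasserstein1 \<mu> \<nu> \<le> (\<integral>\<^sup>+ p. ennreal (dist (fst p) (snd p)) \<partial>\<pi>')"
    by (rule wasserstein1_le)
  also have "\<dots> = (\<integral>\<^sup>+ p. ennreal (dist (fst p) (snd p)) \<partial>\<pi>)"
    by (simp add: \<pi>'_def nn_integral_distr dist_commute)
  finally show "wasserstein1 \<mu> \<nu> \<le> (\<integral>\<^sup>+ p. ennreal (dist (fst p) (snd p)) \<partial>\<pi>)" .
qed

lemma wasserstein1_commute: "wasserstein1 \<mu> \<nu> = wasserstein1 \<nu> \<mu>"
  by (intro antisym wasserstein1_commute_le)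

section \<open>Lipschitz test functions\<close>

text \<open>The easy half of Kantorovich duality: the pointwise Lipschitz bound is integrated
  against the coupling. The additive form avoids differences of possibly infinite integrals, and
  \<open>ennreal\<close> replaces \<open>f\<close> by its positive part, so \<open>f\<close> may
  change sign.\<close>

lemma nn_integral_lipschitz_le_coupling:
  fixes f :: "'y::{metric_space, second_countable_topology} \<Rightarrow> real"
  assumes f: "L-lipschitz_on UNIV f" and \<pi>: "\<pi> \<in> couplings \<mu> \<nu>"
  shows "(\<integral>\<^sup>+ y. ennreal (f y) \<partial>\<mu>) \<le>
    (\<integral>\<^sup>+ y. ennreal (f y) \<partial>\<nu>) + ennreal L * (\<integral>\<^sup>+ p. ennreal (dist (fst p) (snd p)) \<partial>\<pi>)"
proof -
  have L: "0 \<le> L" using f by (rule lipschitz_on_nonneg)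
  have [measurable]: "f \<in> borel_measurable borel"
    using f by (intro borel_measurable_continuous_onI lipschitz_on_continuous_on)
  note [measurable_cong] = couplingsD(2)[OF \<pi>]
  have "(\<integral>\<^sup>+ y. ennreal (f y) \<partial>\<mu>) = (\<integral>\<^sup>+ p. ennreal (f (fst p)) \<partial>\<pi>)"
    by (rule nn_integral_coupling(1)[OF \<pi>, symmetric]) measurable
  also have "\<dots> \<le> (\<integral>\<^sup>+ p. ennreal (f (snd p)) + ennreal L * ennreal (dist (fst p) (snd p)) \<partial>\<pi>)"
  proof (rule nn_integral_mono)
    fix p :: "'y \<times> 'y"
    have "dist (f (fst p)) (f (snd p)) \<le> L * dist (fst p) (snd p)"
      using f by (rule lipschitz_onD) auto
    \<comment> \<open>The \<open>max 0\<close> anticipates the truncation by \<open>ennreal\<close>,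
      which is additive only on nonnegative reals.\<close>
    then have "f (fst p) \<le> max 0 (f (snd p)) + L * dist (fst p) (snd p)"
      by (simp add: dist_real_def)
    then have "ennreal (f (fst p)) \<le> ennreal (max 0 (f (snd p)) + L * dist (fst p) (snd p))"
      by (rule ennreal_leI)
    also have "\<dots> = ennreal (f (snd p)) + ennreal L * ennreal (dist (fst p) (snd p))"
      using L by (simp add: ennreal_plus ennreal_mult max_def ennreal_neg)
    finally show "ennreal (f (fst p)) \<le> \<dots>" .
  qed
  also have "\<dots> = (\<integral>\<^sup>+ p. ennreal (f (snd p)) \<partial>\<pi>) + ennreal L * (\<integral>\<^sup>+ p. ennreal (dist (fst p) (snd p)) \<partial>\<pi>)"
    by (simp add: nn_integral_add nn_integral_cmult)
  also have "(\<integral>\<^sup>+ p. ennreal (f (snd p)) \<partial>\<pi>) = (\<integral>\<^sup>+ y. ennreal (f y) \<partial>\<nu>)"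
    by (rule nn_integral_coupling(2)[OF \<pi>]) measurable
  finally show ?thesis .
qed

text \<open>An infimum of zero need not come with a coupling of cost zero, so couplings of
  arbitrarily small cost are used and the error is sent to zero.\<close>

lemma wasserstein1_eq_0_imp_nn_integral_le:
  assumes W: "wasserstein1 \<mu> \<nu> = 0" and f: "L-lipschitz_on UNIV f"
  shows "(\<integral>\<^sup>+ y. ennreal (f y) \<partial>\<mu>) \<le> (\<integral>\<^sup>+ y. ennreal (f y) \<partial>\<nu>)"
proof (rule ennreal_le_epsilon)
  fix e :: real assume e: "0 < e"
  have L: "0 \<le> L" using f by (rule lipschitz_on_nonneg)
  \<comment> \<open>Dividing by \<open>L + 1\<close> rather than \<open>L\<close> also covers
    \<open>L = 0\<close>.\<close>
  have "wasserstein1 \<mu> \<nu> < ennreal (e / (L + 1))" using W e L by simp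
  then obtain \<pi> where \<pi>: "\<pi> \<in> couplings \<mu> \<nu>"
    and cost: "(\<integral>\<^sup>+ p. ennreal (dist (fst p) (snd p)) \<partial>\<pi>) < ennreal (e / (L + 1))"
    by (rule wasserstein1_lessE)
  have "ennreal L * (\<integral>\<^sup>+ p. ennreal (dist (fst p) (snd p)) \<partial>\<pi>) \<le> ennreal L * ennreal (e / (L + 1))"
    using cost by (intro mult_left_mono) auto
  also have "\<dots> = ennreal (L * (e / (L + 1)))" using L e by (intro ennreal_mult[symmetric]) auto
  also have "\<dots> \<le> ennreal e" using L e by (intro ennreal_leI) (simp add: field_simps)
  finally show "(\<integral>\<^sup>+ y. ennreal (f y) \<partial>\<mu>) \<le> (\<integral>\<^sup>+ y. ennreal (f y) \<partial>\<nu>) + ennreal e"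
    using nn_integral_lipschitz_le_coupling[OF f \<pi>] by (meson add_left_mono order_trans)
qed

section \<open>Gluing of couplings and the triangle inequality\<close>

text \<open>Supplies the cells for gluing. A point is indexed by the first member of an enumerated
  dense set within \<open>e / 2\<close> of it, so two points with the same index are close to a
  common centre.\<close>

lemma small_partition:
  assumes "0 < e"
  obtains idx :: "'y::{metric_space, second_countable_topology} \<Rightarrow> nat"
  where "idx \<in> borel \<rightarrow>\<^sub>M count_space UNIV" "\<And>y y'. idx y = idx y' \<Longrightarrow> dist y y' \<le> e"
proof -
  obtain D :: "'y set" where D: "countable D" "\<And>X. open X \<Longrightarrow> X \<noteq> {} \<Longrightarrow> \<exists>d\<in>D. d \<in> X"
    using countable_dense_setE by blast
  have "D \<noteq> {}" using D(2)[of UNIV] by auto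
  define idx where "idx y = (LEAST n. dist y (from_nat_into D n) < e / 2)" for y
  have idx: "dist y (from_nat_into D (idx y)) < e / 2" for y
  proof -
    obtain d where "d \<in> D" "d \<in> ball y (e / 2)" using D(2)[of "ball y (e/2)"] assms by auto
    then have "dist y (from_nat_into D (to_nat_on D d)) < e / 2" using D(1) by simp
    then show ?thesis unfolding idx_def by (rule LeastI)
  qed
  show ?thesis
  proof
    show "idx \<in> borel \<rightarrow>\<^sub>M count_space UNIV" unfolding idx_def by measurable
    fix y y' assume eq: "idx y = idx y'"
    have "dist y y' \<le> dist y (from_nat_into D (idx y)) + dist y' (from_nat_into D (idx y))"
      by (rule dist_triangle2)
    then show "dist y y' \<le> e" using idx[of y] idx[of y'] eq by simp
  qed
qed

lemma wasserstein1_triangle_approx: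
  fixes \<pi> :: "('y \<times> 'y::{metric_space, second_countable_topology}) measure"
  assumes \<pi>: "\<pi> \<in> couplings \<mu> \<nu>" and \<rho>: "\<rho> \<in> couplings \<nu> \<kappa>" and e: "0 < e"
  shows "wasserstein1 \<mu> \<kappa> \<le> (\<integral>\<^sup>+ p. ennreal (dist (fst p) (snd p)) \<partial>\<pi>)
    + (\<integral>\<^sup>+ p. ennreal (dist (fst p) (snd p)) \<partial>\<rho>) + ennreal e"
proof -
  obtain idx :: "'y \<Rightarrow> nat" where idx[measurable]: "idx \<in> borel \<rightarrow>\<^sub>M count_space UNIV"
    and small: "\<And>y y'. idx y = idx y' \<Longrightarrow> dist y y' \<le> e"
    using small_partition[OF e] by blast
  note [measurable_cong] = couplingsD(2)[OF \<pi>] couplingsD(2)[OF \<rho>]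
  interpret \<pi>: prob_space \<pi> by (rule couplingsD(1)[OF \<pi>])
  interpret \<rho>: prob_space \<rho> by (rule couplingsD(1)[OF \<rho>])
  interpret P: pair_sigma_finite \<pi> \<rho> ..
  have \<nu>_prob: "prob_space \<nu>"
    using \<pi>.prob_space_distr[of snd borel] couplingsD(4)[OF \<pi>] by simp
  interpret \<nu>: prob_space \<nu> by (rule \<nu>_prob)
  have sets_\<nu>[measurable_cong]: "sets \<nu> = sets borel"
    using couplingsD(4)[OF \<pi>] by (metis sets_distr)
  have space_\<nu>: "space \<nu> = UNIV" using sets_eq_imp_space_eq[OF sets_\<nu>] by simp
  define m where "m i = emeasure \<nu> {y. idx y = i}" for i
  have B[measurable]: "{y. idx y = i} \<in> sets \<nu>" for i
    using measurable_sets[OF idx, of "{i}"] by (simp add: vimage_def sets_\<nu>)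
  \<comment> \<open>The weight \<open>inverse (m i)\<close> below is \<open>\<infinity>\<close> on null cells, which are thus excluded first.\<close>
  have AE_m: "AE y in \<nu>. m (idx y) \<noteq> 0"
  proof -
    have "AE y in \<nu>. \<forall>i\<in>{i. m i = 0}. idx y \<noteq> i"
    proof (subst AE_ball_countable)
      show "\<forall>i\<in>{i. m i = 0}. AE y in \<nu>. idx y \<noteq> i"
        by (auto simp: m_def intro!: AE_I[of _ _ "{y. idx y = i}" for i])
    qed simp
    then show ?thesis by eventually_elim auto
  qed
  \<comment> \<open>Two middle points drawn independently from \<open>\<nu>\<close> both land in
    cell \<open>i\<close> with probability \<open>m i * m i\<close>. The weight
    \<open>inverse (m i)\<close> restores the mass \<open>m i\<close>, and pairs in different cells
    are discarded.\<close>
  define w :: "nat \<times> nat \<Rightarrow> ennreal" where "w ij = (if fst ij = snd ij then inverse (m (fst ij)) else 0)" for ij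
  have w_commute: "w (i, j) = w (j, i)" for i j by (auto simp: w_def)
  have [measurable]: "w \<in> borel_measurable (count_space UNIV \<Otimes>\<^sub>M count_space UNIV)"
    by (simp add: pair_measure_countable)
  \<comment> \<open>This normalization makes the marginals of the glued measure correct: once one
    middle point is fixed in a non-null cell, the weight integrates to 1 over the other.\<close>
  have w_int: "(\<integral>\<^sup>+ y. w (i, idx y) \<partial>\<nu>) = 1" if "m i \<noteq> 0" for i
  proof -
    have "(\<integral>\<^sup>+ y. w (i, idx y) \<partial>\<nu>) = (\<integral>\<^sup>+ y. inverse (m i) * indicator {y. idx y = i} y \<partial>\<nu>)"
      by (rule nn_integral_cong) (auto simp: w_def indicator_def)
    also have "\<dots> = inverse (m i) * m i" by (simp add: nn_integral_cmult_indicator m_def)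
    also have "\<dots> = 1"
      using that \<nu>.emeasure_finite[of "{y. idx y = i}"]
      by (metis ennreal_divide_self divide_ennreal_def m_def mult.commute less_top)
    finally show ?thesis .
  qed
  define h where "h q = w (idx (snd (fst q)), idx (fst (snd q)))" for q :: "('y \<times> 'y) \<times> 'y \<times> 'y"
  have h[measurable]: "h \<in> borel_measurable (\<pi> \<Otimes>\<^sub>M \<rho>)" unfolding h_def by measurable
  \<comment> \<open>\<open>R\<close> lives on quadruples: a pair from \<open>\<pi>\<close> and a
    pair from \<open>\<rho>\<close> whose two middle points share a cell without having to
    coincide.\<close>
  define R where "R = density (\<pi> \<Otimes>\<^sub>M \<rho>) h"
  \<comment> \<open>By Fubini the second pair is integrated out first; only its
    \<open>\<nu>\<close>-distributed coordinate enters the weight, so \<open>w_int\<close> applies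
    for almost every first pair.\<close>
  have R_fst: "(\<integral>\<^sup>+ q. f (fst q) \<partial>R) = (\<integral>\<^sup>+ p. f p \<partial>\<pi>)"
    if [measurable]: "f \<in> borel_measurable (borel \<Otimes>\<^sub>M borel)" for f
  proof -
    have "(\<integral>\<^sup>+ q. f (fst q) \<partial>R) = (\<integral>\<^sup>+ q. h q * f (fst q) \<partial>(\<pi> \<Otimes>\<^sub>M \<rho>))"
      unfolding R_def by (rule nn_integral_density) measurable
    also have "\<dots> = (\<integral>\<^sup>+ p. \<integral>\<^sup>+ p'. h (p, p') * f p \<partial>\<rho> \<partial>\<pi>)"
      by (subst \<rho>.nn_integral_fst[symmetric]) simp_all
    also have "\<dots> = (\<integral>\<^sup>+ p. f p \<partial>\<pi>)"
    proof (rule nn_integral_cong_AE)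
      have "AE p in \<pi>. m (idx (snd p)) \<noteq> 0"
        using AE_m by (subst (asm) couplingsD(4)[OF \<pi>, symmetric], subst (asm) AE_distr_iff) simp_all
      then show "AE p in \<pi>. (\<integral>\<^sup>+ p'. h (p, p') * f p \<partial>\<rho>) = f p"
      proof eventually_elim
        case (elim p)
        have "(\<integral>\<^sup>+ p'. h (p, p') * f p \<partial>\<rho>) = (\<integral>\<^sup>+ p'. w (idx (snd p), idx (fst p')) \<partial>\<rho>) * f p"
          unfolding h_def by (simp add: nn_integral_multc)
        also have "(\<integral>\<^sup>+ p'. w (idx (snd p), idx (fst p')) \<partial>\<rho>) = (\<integral>\<^sup>+ y. w (idx (snd p), idx y) \<partial>\<nu>)"
          by (rule nn_integral_coupling(1)[OF \<rho>]) measurable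
        finally show ?case using w_int[OF elim] by simp
      qed
    qed
    finally show ?thesis .
  qed
  \<comment> \<open>The mirror image of \<open>R_fst\<close>, with Fubini in the other order;
    \<open>w_commute\<close> moves the fixed cell to the slot expected by
    \<open>w_int\<close>.\<close>
  have R_snd: "(\<integral>\<^sup>+ q. f (snd q) \<partial>R) = (\<integral>\<^sup>+ p. f p \<partial>\<rho>)"
    if [measurable]: "f \<in> borel_measurable (borel \<Otimes>\<^sub>M borel)" for f
  proof -
    have "(\<integral>\<^sup>+ q. f (snd q) \<partial>R) = (\<integral>\<^sup>+ q. h q * f (snd q) \<partial>(\<pi> \<Otimes>\<^sub>M \<rho>))"
      unfolding R_def by (rule nn_integral_density) measurable
    also have "\<dots> = (\<integral>\<^sup>+ p. \<integral>\<^sup>+ p'. h (p', p) * f p \<partial>\<pi> \<partial>\<rho>)"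
      by (subst P.nn_integral_snd[symmetric]) simp_all
    also have "\<dots> = (\<integral>\<^sup>+ p. f p \<partial>\<rho>)"
    proof (rule nn_integral_cong_AE)
      have "AE p in \<rho>. m (idx (fst p)) \<noteq> 0"
        using AE_m by (subst (asm) couplingsD(3)[OF \<rho>, symmetric], subst (asm) AE_distr_iff) simp_all
      then show "AE p in \<rho>. (\<integral>\<^sup>+ p'. h (p', p) * f p \<partial>\<pi>) = f p"
      proof eventually_elim
        case (elim p)
        have "(\<integral>\<^sup>+ p'. h (p', p) * f p \<partial>\<pi>) = (\<integral>\<^sup>+ p'. w (idx (fst p), idx (snd p')) \<partial>\<pi>) * f p"
          unfolding h_def by (simp add: nn_integral_multc w_commute[of _ "idx (fst p)"])
        also have "(\<integral>\<^sup>+ p'. w (idx (fst p), idx (snd p')) \<partial>\<pi>) = (\<integral>\<^sup>+ y. w (idx (fst p), idx y) \<partial>\<nu>)"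
          by (rule nn_integral_coupling(2)[OF \<pi>]) measurable
        finally show ?case using w_int[OF elim] by simp
      qed
    qed
    finally show ?thesis .
  qed
  have [measurable_cong]: "sets R = sets ((borel \<Otimes>\<^sub>M borel) \<Otimes>\<^sub>M (borel \<Otimes>\<^sub>M borel))"
    unfolding R_def sets_density by (intro sets_pair_measure_cong couplingsD(2)[OF \<pi>] couplingsD(2)[OF \<rho>])
  have R_one: "(\<integral>\<^sup>+ q. 1 \<partial>R) = 1"
    using R_fst[of "\<lambda>_. 1"] \<pi>.emeasure_space_1 by simp
  \<comment> \<open>Only the two outer points are kept.\<close>
  define \<gamma> where "\<gamma> = distr R (borel \<Otimes>\<^sub>M borel) (\<lambda>q. (fst (fst q), snd (snd q)))"
  have "\<gamma> \<in> couplings \<mu> \<kappa>"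
  proof (rule couplingsI)
    have "prob_space R" using R_one by (intro prob_spaceI) simp
    then show "prob_space \<gamma>" unfolding \<gamma>_def by (rule prob_space.prob_space_distr) measurable
    show "sets \<gamma> = sets (borel \<Otimes>\<^sub>M borel)" by (simp add: \<gamma>_def)
    show "distr \<gamma> borel fst = \<mu>"
    proof (rule measure_eqI)
      show s: "sets (distr \<gamma> borel fst) = sets \<mu>" using couplingsD(3)[OF \<pi>] by (metis sets_distr)
      fix A assume "A \<in> sets (distr \<gamma> borel fst)"
      then have [measurable]: "A \<in> sets borel" by simp
      have "emeasure (distr \<gamma> borel fst) A = (\<integral>\<^sup>+ y. indicator A y \<partial>distr \<gamma> borel fst)" by simp
      also have "\<dots> = (\<integral>\<^sup>+ q. indicator A (fst (fst q)) \<partial>R)"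
        by (simp add: \<gamma>_def distr_distr comp_def nn_integral_distr del: nn_integral_indicator)
      also have "\<dots> = (\<integral>\<^sup>+ p. indicator A (fst p) \<partial>\<pi>)" by (rule R_fst) measurable
      also have "\<dots> = (\<integral>\<^sup>+ y. indicator A y \<partial>\<mu>)" by (rule nn_integral_coupling(1)[OF \<pi>]) measurable
      finally show "emeasure (distr \<gamma> borel fst) A = emeasure \<mu> A" using s by (simp add: nn_integral_indicator flip: s)
    qed
    show "distr \<gamma> borel snd = \<kappa>"
    proof (rule measure_eqI)
      show s: "sets (distr \<gamma> borel snd) = sets \<kappa>" using couplingsD(4)[OF \<rho>] by (metis sets_distr)
      fix A assume "A \<in> sets (distr \<gamma> borel snd)"
      then have [measurable]: "A \<in> sets borel" by simp
      have "emeasure (distr \<gamma> borel snd) A = (\<integral>\<^sup>+ y. indicator A y \<partial>distr \<gamma> borel snd)" by simp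
      also have "\<dots> = (\<integral>\<^sup>+ q. indicator A (snd (snd q)) \<partial>R)"
        by (simp add: \<gamma>_def distr_distr comp_def nn_integral_distr del: nn_integral_indicator)
      also have "\<dots> = (\<integral>\<^sup>+ p. indicator A (snd p) \<partial>\<rho>)" by (rule R_snd) measurable
      also have "\<dots> = (\<integral>\<^sup>+ y. indicator A y \<partial>\<kappa>)" by (rule nn_integral_coupling(2)[OF \<rho>]) measurable
      finally show "emeasure (distr \<gamma> borel snd) A = emeasure \<kappa> A" using s by (simp add: nn_integral_indicator flip: s)
    qed
  qed
  then have "wasserstein1 \<mu> \<kappa> \<le> (\<integral>\<^sup>+ p. ennreal (dist (fst p) (snd p)) \<partial>\<gamma>)"
    by (rule wasserstein1_le)
  also have "\<dots> = (\<integral>\<^sup>+ q. ennreal (dist (fst (fst q)) (snd (snd q))) \<partial>R)"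
    by (simp add: \<gamma>_def nn_integral_distr)
  also have "\<dots> \<le> (\<integral>\<^sup>+ q. ennreal (dist (fst (fst q)) (snd (fst q)))
      + ennreal (dist (fst (snd q)) (snd (snd q))) + ennreal e \<partial>R)"
  proof (rule nn_integral_mono_AE)
    \<comment> \<open>A density gives no mass to its own zero set; off that set the middle points
      share a cell, and the jump between them costs at most \<open>e\<close>.\<close>
    have "AE q in R. h q \<noteq> 0"
      unfolding R_def by (subst AE_density) (auto intro: AE_I2 simp: zero_less_iff_neq_zero)
    then show "AE q in R. ennreal (dist (fst (fst q)) (snd (snd q))) \<le>
      ennreal (dist (fst (fst q)) (snd (fst q))) + ennreal (dist (fst (snd q)) (snd (snd q))) + ennreal e"
    proof eventually_elim
      case (elim q)
      then have "dist (snd (fst q)) (fst (snd q)) \<le> e"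
        by (intro small) (auto simp: h_def w_def split: if_splits)
      then have "dist (fst (fst q)) (snd (snd q)) \<le>
          dist (fst (fst q)) (snd (fst q)) + dist (fst (snd q)) (snd (snd q)) + e"
        using dist_triangle[of "fst (fst q)" "snd (snd q)" "snd (fst q)"]
          dist_triangle[of "snd (fst q)" "snd (snd q)" "fst (snd q)"] by linarith
      then show ?case using e by (simp add: ennreal_leI flip: ennreal_plus)
    qed
  qed
  also have "\<dots> = (\<integral>\<^sup>+ q. ennreal (dist (fst (fst q)) (snd (fst q))) \<partial>R)
      + (\<integral>\<^sup>+ q. ennreal (dist (fst (snd q)) (snd (snd q))) \<partial>R) + ennreal e * (\<integral>\<^sup>+ q. 1 \<partial>R)"
    by (simp add: nn_integral_add)
  also have "(\<integral>\<^sup>+ q. ennreal (dist (fst (fst q)) (snd (fst q))) \<partial>R) = (\<integral>\<^sup>+ p. ennreal (dist (fst p) (snd p)) \<partial>\<pi>)"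
    by (rule R_fst) measurable
  also have "(\<integral>\<^sup>+ q. ennreal (dist (fst (snd q)) (snd (snd q))) \<partial>R) = (\<integral>\<^sup>+ p. ennreal (dist (fst p) (snd p)) \<partial>\<rho>)"
    by (rule R_snd) measurable
  finally show ?thesis using R_one by simp
qed

lemma wasserstein1_triangle:
  "wasserstein1 \<mu> \<kappa> \<le> wasserstein1 \<mu> \<nu> + wasserstein1 \<nu> \<kappa>"
proof (cases "wasserstein1 \<mu> \<nu> = \<infinity> \<or> wasserstein1 \<nu> \<kappa> = \<infinity>")
  case False
  show ?thesis
  proof (rule ennreal_le_epsilon)
    fix e :: real assume e: "0 < e"
    \<comment> \<open>Finiteness of both distances is what makes these inequalities strict. The
      error is split in three: one share for each near-optimal coupling and one for the
      gluing.\<close>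
    have less: "wasserstein1 \<mu> \<nu> < wasserstein1 \<mu> \<nu> + ennreal (e / 3)"
      "wasserstein1 \<nu> \<kappa> < wasserstein1 \<nu> \<kappa> + ennreal (e / 3)"
      using False e ennreal_add_left_cancel_less[of _ 0 "ennreal (e / 3)"] by auto
    obtain \<pi> where \<pi>: "\<pi> \<in> couplings \<mu> \<nu>"
      "(\<integral>\<^sup>+ p. ennreal (dist (fst p) (snd p)) \<partial>\<pi>) < wasserstein1 \<mu> \<nu> + ennreal (e / 3)"
      using less(1) by (rule wasserstein1_lessE)
    obtain \<rho> where \<rho>: "\<rho> \<in> couplings \<nu> \<kappa>"
      "(\<integral>\<^sup>+ p. ennreal (dist (fst p) (snd p)) \<partial>\<rho>) < wasserstein1 \<nu> \<kappa> + ennreal (e / 3)"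
      using less(2) by (rule wasserstein1_lessE)
    have "wasserstein1 \<mu> \<kappa> \<le> (\<integral>\<^sup>+ p. ennreal (dist (fst p) (snd p)) \<partial>\<pi>)
        + (\<integral>\<^sup>+ p. ennreal (dist (fst p) (snd p)) \<partial>\<rho>) + ennreal (e / 3)"
      using \<pi>(1) \<rho>(1) e by (intro wasserstein1_triangle_approx) auto
    also have "\<dots> \<le> (wasserstein1 \<mu> \<nu> + ennreal (e / 3)) + (wasserstein1 \<nu> \<kappa> + ennreal (e / 3)) + ennreal (e / 3)"
      using \<pi>(2) \<rho>(2) by (intro add_mono) auto
    also have "\<dots> = wasserstein1 \<mu> \<nu> + wasserstein1 \<nu> \<kappa> + (ennreal (e / 3) + ennreal (e / 3) + ennreal (e / 3))"
      by (simp add: ac_simps)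
    also have "ennreal (e / 3) + ennreal (e / 3) + ennreal (e / 3) = ennreal e"
      using e by (simp flip: ennreal_plus)
    finally show "wasserstein1 \<mu> \<kappa> \<le> wasserstein1 \<mu> \<nu> + wasserstein1 \<nu> \<kappa> + ennreal e" .
  qed
qed auto

section \<open>Distance zero forces equality\<close>

text \<open>The indicator of an open set is the increasing limit of the Lipschitz functions
  \<open>min 1 (n * infdist y (- U))\<close>, so the comparison of integrals passes to
  \<open>U\<close> by monotone convergence.\<close>

lemma wasserstein1_eq_0_imp_emeasure_le:
  fixes \<mu> :: "'y::{metric_space, second_countable_topology} measure"
  assumes \<mu>: "\<mu> \<in> distributions" and \<nu>: "\<nu> \<in> distributions" and W: "wasserstein1 \<mu> \<nu> = 0" and U: "open U"
  shows "emeasure \<mu> U \<le> emeasure \<nu> U"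
proof (cases "U = UNIV")
  case True
  then show ?thesis using \<mu> \<nu> sets_eq_imp_space_eq[of \<mu> borel] sets_eq_imp_space_eq[of \<nu> borel]
    by (metis distributions_iff order_refl prob_space.emeasure_space_1 space_borel)
next
  case False
  \<comment> \<open>By convention \<open>infdist\<close> to the empty set is 0, so the approximation
    would vanish identically for \<open>U = UNIV\<close>.\<close>
  then have ne: "- U \<noteq> {}" by auto
  have [measurable_cong]: "sets \<mu> = sets borel" "sets \<nu> = sets borel" using \<mu> \<nu> by (auto simp: distributions_iff)
  have [measurable]: "U \<in> sets borel" using U by simp
  define f where "f n y = min 1 (real n * infdist y (- U))" for n :: nat and y
  have f_le: "ennreal (f n y) \<le> indicator U y" for n y
    by (cases "y \<in> U") (auto simp: f_def ennreal_le_1)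
  have lip: "(real n)-lipschitz_on UNIV (f n)" for n
  proof (rule lipschitz_onI)
    fix x y
    have "\<bar>infdist x (- U) - infdist y (- U)\<bar> \<le> dist x y" by (rule infdist_triangle_abs)
    then have "real n * \<bar>infdist x (- U) - infdist y (- U)\<bar> \<le> real n * dist x y"
      by (rule mult_left_mono) simp
    then have "\<bar>real n * infdist x (- U) - real n * infdist y (- U)\<bar> \<le> real n * dist x y"
      by (simp add: abs_mult flip: right_diff_distrib)
    then show "dist (f n x) (f n y) \<le> real n * dist x y"
      by (auto simp: f_def dist_real_def min_def abs_if split: if_splits)
  qed simp
  have [measurable]: "f n \<in> borel_measurable borel" for n
    unfolding f_def by (intro borel_measurable_continuous_onI continuous_intros)
  have sup: "(SUP n. ennreal (f n y)) = indicator U y" for y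
  proof (rule antisym)
    show "(SUP n. ennreal (f n y)) \<le> indicator U y" using f_le by (rule SUP_least)
    show "indicator U y \<le> (SUP n. ennreal (f n y))"
    proof (cases "y \<in> U")
      case True
      \<comment> \<open>The complement is closed, so a point of \<open>U\<close> lies at positive
        distance from it and \<open>f n\<close> reaches 1 there for large \<open>n\<close>.\<close>
      then have "0 < infdist y (- U)"
        using U ne in_closed_iff_infdist_zero[of "- U" y] infdist_nonneg[of y "- U"] by force
      then obtain n where "1 < real n * infdist y (- U)" using reals_Archimedean3 by blast
      then have "ennreal (f n y) = 1" by (simp add: f_def)
      then show ?thesis using True by (intro SUP_upper2[of n]) auto
    qed simp
  qed
  have inc: "incseq (\<lambda>n y. ennreal (f n y))"
    by (auto simp: incseq_def le_fun_def f_def intro!: ennreal_leI min.mono mult_right_mono infdist_nonneg)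
  have "emeasure \<mu> U = (\<integral>\<^sup>+ y. (SUP n. ennreal (f n y)) \<partial>\<mu>)" by (simp add: sup)
  also have "\<dots> = (SUP n. \<integral>\<^sup>+ y. ennreal (f n y) \<partial>\<mu>)"
    by (rule nn_integral_monotone_convergence_SUP[OF inc]) measurable
  also have "\<dots> \<le> emeasure \<nu> U"
  proof (rule SUP_least)
    fix n
    have "(\<integral>\<^sup>+ y. ennreal (f n y) \<partial>\<mu>) \<le> (\<integral>\<^sup>+ y. ennreal (f n y) \<partial>\<nu>)"
      by (rule wasserstein1_eq_0_imp_nn_integral_le[OF W lip])
    also have "\<dots> \<le> (\<integral>\<^sup>+ y. indicator U y \<partial>\<nu>)" by (rule nn_integral_mono) (rule f_le)
    finally show "(\<integral>\<^sup>+ y. ennreal (f n y) \<partial>\<mu>) \<le> emeasure \<nu> U" by simp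
  qed
  finally show ?thesis .
qed

text \<open>By symmetry the measures agree on all open sets, an intersection-stable generator of the
  Borel sets that contains the whole space, which has finite mass.\<close>

lemma wasserstein1_eq_0_iff:
  fixes \<mu> :: "'y::{metric_space, second_countable_topology} measure"
  assumes \<mu>: "\<mu> \<in> distributions" and \<nu>: "\<nu> \<in> distributions"
  shows "wasserstein1 \<mu> \<nu> = 0 \<longleftrightarrow> \<mu> = \<nu>"
proof
  assume W: "wasserstein1 \<mu> \<nu> = 0"
  interpret \<mu>: prob_space \<mu> using \<mu> by (simp add: distributions_iff)
  have "emeasure \<mu> U = emeasure \<nu> U" if "open U" for U
    using wasserstein1_eq_0_imp_emeasure_le[OF \<mu> \<nu> W that]
      wasserstein1_eq_0_imp_emeasure_le[OF \<nu> \<mu> _ that] W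
    by (simp add: wasserstein1_commute[of \<nu> \<mu>])
  then show "\<mu> = \<nu>"
    using \<mu> \<nu> \<mu>.emeasure_finite[of UNIV]
    by (intro measure_eqI_generator_eq[of "Collect open" UNIV \<mu> \<nu> "\<lambda>_. UNIV"])
      (auto simp: Int_stable_def distributions_iff borel_def)
qed (use \<mu> wasserstein1_refl in auto)

lemma extended_metric_wasserstein1: "extended_metric_on distributions wasserstein1"
  unfolding extended_metric_on_def
  using wasserstein1_eq_0_iff wasserstein1_commute wasserstein1_triangle by blast

section \<open>Arbitrary norms in finite dimension\<close>

lemma is_norm_nonneg: "is_norm N \<Longrightarrow> 0 \<le> N x"
proof -
  assume N: "is_norm N"
  then have "N (x + (- 1) *\<^sub>R x) \<le> N x + N ((- 1) *\<^sub>R x)" "N ((- 1) *\<^sub>R x) = N x" "N 0 = 0"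
    unfolding is_norm_def by (blast, metis abs_minus_cancel abs_one mult_1, blast)
  then show ?thesis by simp
qed

lemma is_norm_minus_commute: "is_norm N \<Longrightarrow> N (x - y) = N (y - x)"
proof -
  assume "is_norm N"
  then have "N ((- 1) *\<^sub>R (y - x)) = \<bar>- 1\<bar> * N (y - x)" unfolding is_norm_def by blast
  then show ?thesis by simp
qed

text \<open>Expansion in the orthonormal basis bounds \<open>N\<close> by its values on basis
  vectors.\<close>

lemma is_norm_le_norm:
  fixes N :: "'v::euclidean_space \<Rightarrow> real"
  assumes N: "is_norm N"
  obtains C where "0 < C" "\<And>x. N x \<le> C * norm x"
proof
  have sum_le: "N (\<Sum>i\<in>I. g i) \<le> (\<Sum>i\<in>I. N (g i))" if "finite I" for I :: "'v set" and g
    using that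
  proof induction
    case empty
    have "N 0 = 0" using N unfolding is_norm_def by blast
    then show ?case by simp
  next
    case (insert i I)
    have "N (g i + sum g I) \<le> N (g i) + N (sum g I)" using N unfolding is_norm_def by blast
    with insert show ?case by simp
  qed
  have nn: "0 \<le> (\<Sum>b\<in>Basis. N b)" by (intro sum_nonneg is_norm_nonneg[OF N])
  then show "0 < (\<Sum>b\<in>Basis. N b) + 1" by simp
  fix x
  have "N x = N (\<Sum>b\<in>Basis. (x \<bullet> b) *\<^sub>R b)" by (simp add: euclidean_representation)
  also have "\<dots> \<le> (\<Sum>b\<in>Basis. N ((x \<bullet> b) *\<^sub>R b))" by (rule sum_le) simp
  also have "\<dots> = (\<Sum>b\<in>Basis. \<bar>x \<bullet> b\<bar> * N b)" using N by (simp add: is_norm_def)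
  also have "\<dots> \<le> (\<Sum>b\<in>Basis. norm x * N b)"
    by (intro sum_mono mult_right_mono Basis_le_norm is_norm_nonneg[OF N])
  also have "\<dots> \<le> ((\<Sum>b\<in>Basis. N b) + 1) * norm x"
    by (simp add: algebra_simps sum_distrib_left)
  finally show "N x \<le> ((\<Sum>b\<in>Basis. N b) + 1) * norm x" .
qed

text \<open>The upper bound makes \<open>N\<close> Lipschitz, so it attains a minimum on the compact
  unit sphere. Definiteness makes this minimum positive, and homogeneity carries the bound to all
  vectors.\<close>

lemma norm_le_is_norm:
  fixes N :: "'v::euclidean_space \<Rightarrow> real"
  assumes N: "is_norm N"
  obtains c where "0 < c" "\<And>x. c * norm x \<le> N x"
proof -
  obtain C where C: "0 < C" "\<And>x. N x \<le> C * norm x" using is_norm_le_norm[OF N] by blast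
  have sub: "N x - N y \<le> N (x - y)" for x y
  proof -
    have "N ((x - y) + y) \<le> N (x - y) + N y" using N unfolding is_norm_def by blast
    then show ?thesis by simp
  qed
  have "C-lipschitz_on (sphere 0 1) N"
  proof (rule lipschitz_onI)
    fix x y
    show "dist (N x) (N y) \<le> C * dist x y"
      using sub[of x y] sub[of y x] is_norm_minus_commute[OF N, of x y] C(2)[of "x - y"]
      by (simp add: dist_norm)
  qed (use C in simp)
  then have "continuous_on (sphere 0 1) N" by (rule lipschitz_on_continuous_on)
  moreover have "sphere (0::'v) 1 \<noteq> {}" by simp
  ultimately obtain z where z: "z \<in> sphere 0 1" "\<And>x. x \<in> sphere 0 1 \<Longrightarrow> N z \<le> N x"
    using continuous_attains_inf[OF compact_sphere] by blast
  have "z \<noteq> 0" using z(1) by auto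
  then have "N z \<noteq> 0" using N by (simp add: is_norm_def)
  then have "0 < N z" using is_norm_nonneg[OF N, of z] by simp
  moreover have "N z * norm x \<le> N x" for x
  proof (cases "x = 0")
    case False
    have "N z \<le> N ((1 / norm x) *\<^sub>R x)" using False by (intro z(2)) simp
    also have "\<dots> = \<bar>1 / norm x\<bar> * N x" using N unfolding is_norm_def by blast
    finally show ?thesis using False by (simp add: field_simps)
  qed (simp add: is_norm_nonneg[OF N])
  ultimately show ?thesis using that by blast
qed

text \<open>
  By equivalence of norms, a high iterate of \<open>G\<close> contracts the library norm, and \<open>G\<close> permutes the
  fixed points of that iterate.
\<close>

lemma is_norm_contraction_fixed_point:
  fixes G :: "'v::euclidean_space \<Rightarrow> 'v"
  assumes N: "is_norm N" and k: "0 \<le> k" "k < 1" and G: "\<And>x y. N (G x - G y) \<le> k * N (x - y)"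
  shows "\<exists>!x. G x = x"
proof -
  obtain C where C: "0 < C" "\<And>x. N x \<le> C * norm x" using is_norm_le_norm[OF N] by blast
  obtain c where c: "0 < c" "\<And>x. c * norm x \<le> N x" using norm_le_is_norm[OF N] by blast
  have pow: "N ((G ^^ n) x - (G ^^ n) y) \<le> k ^ n * N (x - y)" for n x y
  proof (induction n)
    case (Suc n)
    have "N ((G ^^ Suc n) x - (G ^^ Suc n) y) \<le> k * N ((G ^^ n) x - (G ^^ n) y)" using G by simp
    also have "\<dots> \<le> k * (k ^ n * N (x - y))" using Suc k by (intro mult_left_mono)
    finally show ?case by (simp add: mult.assoc)
  qed simp
  \<comment> \<open>Passing from the library norm to \<open>N\<close> and back costs a factor
    \<open>C / c\<close>; this \<open>n\<close> lets \<open>k ^ n\<close> absorb it.\<close>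
  obtain n where n: "k ^ n < c / C"
    using real_arch_pow_inv[of "c / C" k] C(1) c(1) k by auto
  have "\<exists>!x. (G ^^ n) x = x"
  proof (rule banach_fix_type)
    show "0 \<le> k ^ n * C / c" "k ^ n * C / c < 1"
      using n k(1) C(1) c(1) by (auto simp: field_simps)
    show "\<forall>x y. dist ((G ^^ n) x) ((G ^^ n) y) \<le> k ^ n * C / c * dist x y"
    proof (intro allI)
      fix x y
      have "c * norm ((G ^^ n) x - (G ^^ n) y) \<le> k ^ n * N (x - y)" using c(2) pow by (rule order_trans)
      also have "\<dots> \<le> k ^ n * (C * norm (x - y))" using C(2) k by (intro mult_left_mono) auto
      finally show "dist ((G ^^ n) x) ((G ^^ n) y) \<le> k ^ n * C / c * dist x y"
        using c(1) by (simp add: dist_norm field_simps)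
    qed
  qed
  then obtain x where x: "(G ^^ n) x = x" "\<And>y. (G ^^ n) y = y \<Longrightarrow> y = x" by blast
  \<comment> \<open>\<open>G\<close> commutes with its iterates, so \<open>G x\<close> is again
    fixed by \<open>G ^^ n\<close> and must equal \<open>x\<close>.\<close>
  have "(G ^^ n) (G x) = G x" using x(1) by (metis funpow_swap1)
  then have "G x = x" by (rule x(2))
  moreover have "y = x" if "G y = y" for y
  proof (rule x(2))
    show "(G ^^ n) y = y" by (induction n) (simp_all add: that)
  qed
  ultimately show ?thesis by blast
qed

section \<open>Contraction, fixed point and convergence\<close>

theorem theorem5:
  fixes CP :: "'y::{metric_space, second_countable_topology} measure \<Rightarrow> real ^ 'h"
    and F :: "real ^ 'h \<Rightarrow> 'y measure"
    and N :: "real ^ 'h \<Rightarrow> real"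
    and L_CP L_MPC :: real
  assumes norm: "is_norm N"
    and F_distr: "\<And>q. F q \<in> distributions"
    and L_CP_nonneg: "0 \<le> L_CP"
    and CP_lipschitz: "\<And>D1 D2. D1 \<in> distributions \<Longrightarrow> D2 \<in> distributions \<Longrightarrow>
      ennreal (N (CP D1 - CP D2)) \<le> ennreal L_CP * wasserstein1 D1 D2"
    and L_MPC_nonneg: "0 \<le> L_MPC"
    and MPC_lipschitz: "\<And>q1 q2. wasserstein1 (F q1) (F q2) \<le> ennreal (L_MPC * N (q1 - q2))"
    and delta: "L_MPC * L_CP < 1"
  shows "contraction_mapping distributions wasserstein1 (F \<circ> CP) \<and>
    (\<exists>Dstar\<in>distributions.
      (\<forall>D\<in>distributions. (F \<circ> CP) D = D \<longleftrightarrow> D = Dstar) \<and>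
      (\<forall>D :: nat \<Rightarrow> 'y measure.
        D 0 \<in> distributions \<longrightarrow> (\<forall>r. D (Suc r) = (F \<circ> CP) (D r)) \<longrightarrow>
        (\<lambda>r. wasserstein1 (D r) Dstar) \<longlonglongrightarrow> 0))"
proof (intro conjI)
  note nn = is_norm_nonneg[OF norm]
  let ?k = "L_MPC * L_CP"
  have k: "0 \<le> ?k" using L_MPC_nonneg L_CP_nonneg by simp
  have contr: "wasserstein1 ((F \<circ> CP) D1) ((F \<circ> CP) D2) \<le> ennreal ?k * wasserstein1 D1 D2"
    if "D1 \<in> distributions" "D2 \<in> distributions" for D1 D2
  proof -
    have "wasserstein1 ((F \<circ> CP) D1) ((F \<circ> CP) D2) \<le> ennreal L_MPC * ennreal (N (CP D1 - CP D2))"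
      using MPC_lipschitz[of "CP D1" "CP D2"] by (simp add: ennreal_mult L_MPC_nonneg nn)
    also have "\<dots> \<le> ennreal L_MPC * (ennreal L_CP * wasserstein1 D1 D2)"
      using CP_lipschitz[OF that] by (rule mult_left_mono) simp
    finally show ?thesis by (simp add: ennreal_mult L_MPC_nonneg L_CP_nonneg mult.assoc)
  qed
  show "contraction_mapping distributions wasserstein1 (F \<circ> CP)"
    unfolding contraction_mapping_def
    using extended_metric_wasserstein1 F_distr contr k delta by auto
  \<comment> \<open>The two Lipschitz bounds are composed in the opposite order. Both ends are now
    finite, so the inequality descends from \<open>ennreal\<close> to the reals.\<close>
  have threshold_contr: "N (CP (F p) - CP (F q)) \<le> ?k * N (p - q)" for p q
  proof -
    have "ennreal (N (CP (F p) - CP (F q))) \<le> ennreal L_CP * wasserstein1 (F p) (F q)"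
      by (intro CP_lipschitz F_distr)
    also have "\<dots> \<le> ennreal L_CP * ennreal (L_MPC * N (p - q))"
      using MPC_lipschitz by (rule mult_left_mono) simp
    also have "\<dots> = ennreal (?k * N (p - q))"
      using L_MPC_nonneg L_CP_nonneg nn[of "p - q"] by (simp add: ac_simps flip: ennreal_mult)
    finally show ?thesis
      using k nn[of "p - q"] by (simp add: ennreal_le_iff)
  qed
  then obtain q where q: "CP (F q) = q" "\<And>p. CP (F p) = p \<Longrightarrow> p = q"
    using is_norm_contraction_fixed_point[OF norm k delta, of "\<lambda>q. CP (F q)"] by blast
  show "\<exists>Dstar\<in>distributions.
      (\<forall>D\<in>distributions. (F \<circ> CP) D = D \<longleftrightarrow> D = Dstar) \<and>
      (\<forall>D :: nat \<Rightarrow> 'y measure.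
        D 0 \<in> distributions \<longrightarrow> (\<forall>r. D (Suc r) = (F \<circ> CP) (D r)) \<longrightarrow>
        (\<lambda>r. wasserstein1 (D r) Dstar) \<longlonglongrightarrow> 0)"
  proof (intro bexI[of _ "F q"] conjI ballI allI impI)
    show "F q \<in> distributions" by (rule F_distr)
    \<comment> \<open>If \<open>F (CP D) = D\<close>, then \<open>CP D\<close> is fixed by
      \<open>CP \<circ> F\<close>, hence equals \<open>q\<close>, and \<open>D = F q\<close>. This
      argument needs no finite distance between \<open>D\<close> and \<open>F q\<close>.\<close>
    show "(F \<circ> CP) D = D \<longleftrightarrow> D = F q" for D
      using q by (metis comp_apply)
    fix D :: "nat \<Rightarrow> 'y measure"
    assume D: "\<forall>r. D (Suc r) = (F \<circ> CP) (D r)"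
    have thresholds: "N (CP (D r) - q) \<le> ?k ^ r * N (CP (D 0) - q)" for r
    proof (induction r)
      case (Suc r)
      have "N (CP (D (Suc r)) - q) \<le> ?k * N (CP (D r) - q)"
        using threshold_contr[of "CP (D r)" q] D q(1) by simp
      also have "\<dots> \<le> ?k * (?k ^ r * N (CP (D 0) - q))" using Suc k by (rule mult_left_mono)
      finally show ?case by (simp add: mult.assoc)
    qed simp
    \<comment> \<open>The bound starts at index 1: \<open>D (Suc r)\<close> lies in the range of
      \<open>F\<close>, hence at finite distance from \<open>F q\<close>, whereas \<open>D 0\<close>
      may be infinitely far away.\<close>
    have bound: "wasserstein1 (D (Suc r)) (F q) \<le> ennreal (L_MPC * (?k ^ r * N (CP (D 0) - q)))" for r
    proof -
      have "wasserstein1 (D (Suc r)) (F q) \<le> ennreal (L_MPC * N (CP (D r) - q))"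
        using MPC_lipschitz[of "CP (D r)" q] D by simp
      also have "\<dots> \<le> ennreal (L_MPC * (?k ^ r * N (CP (D 0) - q)))"
        using thresholds L_MPC_nonneg by (intro ennreal_leI mult_left_mono)
      finally show ?thesis .
    qed
    have lim: "(\<lambda>r. ennreal (L_MPC * (?k ^ r * N (CP (D 0) - q))))
        \<longlonglongrightarrow> ennreal (L_MPC * (0 * N (CP (D 0) - q)))"
      using k delta by (intro tendsto_ennrealI tendsto_intros LIMSEQ_power_zero) simp
    have "(\<lambda>r. wasserstein1 (D (Suc r)) (F q)) \<longlonglongrightarrow> 0"
    proof (rule tendsto_sandwich[OF _ _ tendsto_const])
      show "\<forall>\<^sub>F r in sequentially. 0 \<le> wasserstein1 (D (Suc r)) (F q)" by simp
      show "\<forall>\<^sub>F r in sequentially.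
          wasserstein1 (D (Suc r)) (F q) \<le> ennreal (L_MPC * (?k ^ r * N (CP (D 0) - q)))"
        using bound by (rule always_eventually[OF allI])
      show "(\<lambda>r. ennreal (L_MPC * (?k ^ r * N (CP (D 0) - q)))) \<longlonglongrightarrow> 0" using lim by simp
    qed
    then show "(\<lambda>r. wasserstein1 (D r) (F q)) \<longlonglongrightarrow> 0"
      by (rule LIMSEQ_imp_Suc)
  qed
qed
end
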